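(* Let $k\ge 1$ be an integer, let $W_1=\mathbb{C}\langle z_1,\dots,z_k,\partial/\partial z_1,\dots,\partial/\partial z_k\rangle$ be the Weyl algebra in $k$ variables, and let $W_1^{\mathfrak{S}_k}$ be its subalgebra of $\mathfrak{S}_k$-invariant elements. Then the unital $\mathbb{C}$-algebra $W_1^{\mathfrak{S}_k}$ is generated by the three elements $N_1=\sum_{j=1}^k z_j$, $N_k=\sum_{j=1}^k z_j^k$ and $\mathcal{N}_k=\sum_{j=1}^k(\partial/\partial z_j)^k$.
   Context: The Weyl algebra $W_1$ is the algebra of polynomial-coefficient differential operators in $z_1,\dots,z_k$. The symmetric group $\mathfrak{S}_k$ acts on $W_1$ by algebra automorphisms permuting simultaneously the $z_j$ and the $\partial/\partial z_j$. *)

theory Defs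
  imports Complex_Main "HOL-Library.Poly_Mapping" "HOL-Library.Cardinality" "HOL-Combinatorics.Perm"
begin

text \<open>
  Complex polynomials in variables indexed by \<open>'n\<close>: a monomial is its exponent vector
  \<open>'n \<Rightarrow>\<^sub>0 nat\<close>, and the ring structure is the monoid algebra from the library. For a
  finite type \<open>'n\<close> the number of variables is \<open>CARD('n)\<close>, which is at least 1.
\<close>

type_synonym 'n cpoly = "('n \<Rightarrow>\<^sub>0 nat) \<Rightarrow>\<^sub>0 complex"

definition pscale :: "complex \<Rightarrow> 'n cpoly \<Rightarrow> 'n cpoly"
  where "pscale c f = Poly_Mapping.single 0 c * f"

definition pvar :: "'n \<Rightarrow> 'n cpoly"
  where "pvar j = Poly_Mapping.single (Poly_Mapping.single j 1) 1"

text \<open>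
  The coefficient of \<open>z\<^sup>m\<close> in \<open>\<partial>f / \<partial>z\<^sub>j\<close> is \<open>(m\<^sub>j + 1)\<close> times the coefficient of
  \<open>z\<^sup>m \<sqdot> z\<^sub>j\<close> in \<open>f\<close>.
\<close>

lift_definition pderiv_var :: "'n \<Rightarrow> 'n cpoly \<Rightarrow> 'n cpoly"
  is "\<lambda>j f m. of_nat (Poly_Mapping.lookup m j + 1) * f (m + Poly_Mapping.single j 1)"
proof -
  fix j :: 'n and f :: "('n \<Rightarrow>\<^sub>0 nat) \<Rightarrow> complex"
  assume fin: "finite {m. f m \<noteq> 0}"
  have "finite ((\<lambda>m. m + Poly_Mapping.single j (1::nat)) -` {m. f m \<noteq> 0})"
    by (rule finite_vimageI[OF fin]) (simp add: inj_on_def)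
  then show "finite {m. of_nat (Poly_Mapping.lookup m j + 1) * f (m + Poly_Mapping.single j 1) \<noteq> 0}"
    by (rule rev_finite_subset) auto
qed

text \<open>
  The operators with polynomial coefficients: the unital algebra of endomorphisms of the
  polynomial ring generated by the multiplications by the variables and the partial derivatives.
\<close>

inductive_set weyl_ops :: "('n cpoly \<Rightarrow> 'n cpoly) set" where
  var: "(\<lambda>f. pvar j * f) \<in> weyl_ops"
| deriv: "pderiv_var j \<in> weyl_ops"
| one: "(\<lambda>f. f) \<in> weyl_ops"
| scale: "A \<in> weyl_ops \<Longrightarrow> (\<lambda>f. pscale c (A f)) \<in> weyl_ops"
| add: "A \<in> weyl_ops \<Longrightarrow> B \<in> weyl_ops \<Longrightarrow> (\<lambda>f. A f + B f) \<in> weyl_ops"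
| comp: "A \<in> weyl_ops \<Longrightarrow> B \<in> weyl_ops \<Longrightarrow> (\<lambda>f. A (B f)) \<in> weyl_ops"

lemma pscale_simps:
  "pscale c (f + g) = pscale c f + pscale c g"
  "pscale (c + d) f = pscale c f + pscale d f"
  "pscale c (pscale d f) = pscale (c * d) f"
  "pscale 1 f = f" "pscale 0 f = 0" "pscale (- 1) f = - f"
  "pscale c (h * f) = h * pscale c f"
  unfolding pscale_def
  by (simp_all only: distrib_left distrib_right single_add mult_single add_0 mult.left_commute
      single_one single_zero single_uminus mult_1 mult_zero_left mult_minus_left
      mult.assoc[of "Poly_Mapping.single 0 c" "Poly_Mapping.single 0 d" f, symmetric])

lemma lookup_pscale: "Poly_Mapping.lookup (pscale c f) m = c * Poly_Mapping.lookup f m"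
proof -
  have "pscale c f = Poly_Mapping.map ((*) c) f"
    by (simp add: pscale_def mult_map_scale_conv_mult)
  then show ?thesis by (simp add: map.rep_eq when_def)
qed

lemma pderiv_var_add: "pderiv_var j (f + g) = pderiv_var j f + pderiv_var j g"
  by (rule poly_mapping_eqI) (simp add: pderiv_var.rep_eq lookup_add distrib_left)

lemma pderiv_var_pscale: "pderiv_var j (pscale c f) = pscale c (pderiv_var j f)"
  by (rule poly_mapping_eqI) (simp add: pderiv_var.rep_eq lookup_pscale)

lemma weyl_ops_linear:
  assumes "A \<in> weyl_ops"
  shows "A (f + g) = A f + A g" and "A (pscale c f) = pscale c (A f)"
proof -
  have "(\<forall>f g. A (f + g) = A f + A g) \<and> (\<forall>c f. A (pscale c f) = pscale c (A f))"
    using assms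
  proof induction
    case (scale A d)
    then show ?case
      by (simp add: pscale_simps(1,3) mult.commute)
  qed (simp_all add: pscale_simps(1,7) distrib_left pderiv_var_add pderiv_var_pscale)
  then show "A (f + g) = A f + A g" and "A (pscale c f) = pscale c (A f)"
    by blast+
qed

lemma weyl_ops_zero: "(\<lambda>f. 0) \<in> weyl_ops"
  using weyl_ops.scale[OF weyl_ops.one, of 0] by (simp add: pscale_simps)

lemma weyl_ops_uminus: "A \<in> weyl_ops \<Longrightarrow> (\<lambda>f. - A f) \<in> weyl_ops"
  using weyl_ops.scale[of A "- 1"] by (simp add: pscale_simps)

typedef 'n weyl = "weyl_ops :: ('n cpoly \<Rightarrow> 'n cpoly) set"
  morphisms weyl_apply Abs_weyl
  using weyl_ops.one by blast

setup_lifting type_definition_weyl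

instantiation weyl :: (type) ring_1
begin

lift_definition zero_weyl :: "'n weyl" is "\<lambda>f. 0" by (rule weyl_ops_zero)
lift_definition one_weyl :: "'n weyl" is "\<lambda>f. f" by (rule weyl_ops.one)
lift_definition plus_weyl :: "'n weyl \<Rightarrow> 'n weyl \<Rightarrow> 'n weyl"
  is "\<lambda>A B f. A f + B f" by (rule weyl_ops.add)
lift_definition uminus_weyl :: "'n weyl \<Rightarrow> 'n weyl"
  is "\<lambda>A f. - A f" by (rule weyl_ops_uminus)
lift_definition times_weyl :: "'n weyl \<Rightarrow> 'n weyl \<Rightarrow> 'n weyl"
  is "\<lambda>A B f. A (B f)" by (rule weyl_ops.comp)
definition minus_weyl :: "'n weyl \<Rightarrow> 'n weyl \<Rightarrow> 'n weyl"
  where "minus_weyl a b = a + - b"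

instance
proof
  fix a b c :: "'n weyl"
  show "a + b + c = a + (b + c)" by transfer (simp add: add.assoc)
  show "a + b = b + a" by transfer (simp add: add.commute)
  show "0 + a = a" by transfer simp
  show "- a + a = 0" by transfer simp
  show "a - b = a + - b" by (simp add: minus_weyl_def)
  show "a * b * c = a * (b * c)" by transfer simp
  show "1 * a = a" by transfer simp
  show "a * 1 = a" by transfer simp
  show "(a + b) * c = a * c + b * c" by transfer simp
  show "a * (b + c) = a * b + a * c" by transfer (simp add: weyl_ops_linear)
  show "(0::'n weyl) \<noteq> 1"
    by transfer (metis zero_neq_one)
qed

end

lift_definition weyl_scale :: "complex \<Rightarrow> 'n weyl \<Rightarrow> 'n weyl"
  is "\<lambda>c A f. pscale c (A f)" by (rule weyl_ops.scale)

interpretation weyl: vector_space weyl_scale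
  by unfold_locales (transfer; simp add: pscale_simps)+

lemma weyl_scale_mult:
  "weyl_scale c a * b = weyl_scale c (a * b)"
  "a * weyl_scale c b = weyl_scale c (a * b)"
  by (transfer; simp add: weyl_ops_linear)+

lift_definition weyl_Z :: "'n \<Rightarrow> 'n weyl" is "\<lambda>j f. pvar j * f" by (rule weyl_ops.var)

lift_definition weyl_D :: "'n \<Rightarrow> 'n weyl" is pderiv_var by (rule weyl_ops.deriv)

lemma lookup_pvar_mult:
  "Poly_Mapping.lookup (pvar j * f) m =
    (if Poly_Mapping.lookup m j = 0 then 0
     else Poly_Mapping.lookup f (m - Poly_Mapping.single j 1))"
proof -
  have "Poly_Mapping.lookup (pvar j * f) m =
      (\<Sum>q. Poly_Mapping.lookup f q when m = Poly_Mapping.single j 1 + q)"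
    by (simp add: pvar_def lookup_mult lookup_single when_mult)
  also have "\<dots> = (if Poly_Mapping.lookup m j = 0 then 0
     else Poly_Mapping.lookup f (m - Poly_Mapping.single j 1))"
  proof (cases "Poly_Mapping.lookup m j = 0")
    case True
    then have "m \<noteq> Poly_Mapping.single j 1 + q" for q
      by (auto simp: lookup_add)
    with True show ?thesis by simp
  next
    case False
    then have "m = Poly_Mapping.single j 1 + q \<longleftrightarrow> q = m - Poly_Mapping.single j 1" for q
      by (auto simp: poly_mapping_eq_iff fun_eq_iff lookup_add lookup_minus lookup_single when_def)
    with False show ?thesis by simp
  qed
  finally show ?thesis .
qed

lemma pderiv_var_pvar_mult:
  "pderiv_var i (pvar j * f) = pvar j * pderiv_var i f + (if i = j then f else 0)"
proof (rule poly_mapping_eqI)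
  fix m
  let ?ei = "Poly_Mapping.single i (1::nat)" and ?ej = "Poly_Mapping.single j (1::nat)"
  have *: "m + ?ei - ?ej = m - ?ej + ?ei" if "Poly_Mapping.lookup m j \<noteq> 0"
    using that
    by (intro poly_mapping_eqI) (auto simp: lookup_add lookup_minus lookup_single when_def)
  show "Poly_Mapping.lookup (pderiv_var i (pvar j * f)) m =
      Poly_Mapping.lookup (pvar j * pderiv_var i f + (if i = j then f else 0)) m"
  proof (cases "i = j")
    case True
    show ?thesis
    proof (cases "Poly_Mapping.lookup m j = 0")
      case True
      with \<open>i = j\<close> show ?thesis
        by (simp add: pderiv_var.rep_eq lookup_pvar_mult lookup_add)
    next
      case False
      have "of_nat (Poly_Mapping.lookup m j - 1) + 1 = (of_nat (Poly_Mapping.lookup m j) :: complex)"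
        using False by (simp add: of_nat_diff)
      moreover have "m - ?ej + ?ej = m"
        using * [OF False] \<open>i = j\<close> by simp
      ultimately show ?thesis
        using \<open>i = j\<close> False
        by (simp add: pderiv_var.rep_eq lookup_pvar_mult lookup_add lookup_minus)
          (metis add.commute distrib_right mult_1)
    qed
  next
    case False
    then show ?thesis
      using *
      by (simp add: pderiv_var.rep_eq lookup_pvar_mult lookup_add lookup_minus lookup_single)
  qed
qed

lemma weyl_D_Z: "weyl_D i * weyl_Z j - weyl_Z j * weyl_D i = (if i = j then 1 else 0)"
proof -
  have "weyl_D i * weyl_Z j = weyl_Z j * weyl_D i + (if i = j then 1 else 0)"
    by (cases "i = j"; simp; transfer; simp add: pderiv_var_pvar_mult)
  then show ?thesis by simp
qed

text \<open>
  Substitution \<open>z\<^sub>j \<mapsto> z\<^bsub>\<sigma> j\<^esub>\<close>: the coefficient of \<open>z\<^sup>m\<close> in \<open>\<sigma> f\<close> is the coefficient of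
  \<open>z\<^bsup>m \<circ> \<sigma>\<^esup>\<close> in \<open>f\<close>. For finite \<open>'n\<close> the type \<open>'n perm\<close> is the full symmetric group.
\<close>

definition pperm :: "'n perm \<Rightarrow> 'n cpoly \<Rightarrow> 'n cpoly"
  where "pperm \<sigma> f = Poly_Mapping.map_key (Poly_Mapping.map_key (Perm.apply \<sigma>)) f"

lemma inj_perm_apply: "inj (Perm.apply \<sigma>)"
  by (simp add: bij_is_inj)

lemma lookup_map_key_perm:
  "Poly_Mapping.lookup (Poly_Mapping.map_key (Perm.apply \<sigma>) m) i
    = Poly_Mapping.lookup m (Perm.apply \<sigma> i)"
  by (simp add: map_key.rep_eq inj_perm_apply)

lemma inj_map_key_perm:
  "inj (Poly_Mapping.map_key (Perm.apply \<sigma>) :: ('n \<Rightarrow>\<^sub>0 nat) \<Rightarrow> _)"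
proof (rule injI)
  fix m n :: "'n \<Rightarrow>\<^sub>0 nat"
  assume eq: "Poly_Mapping.map_key (Perm.apply \<sigma>) m = Poly_Mapping.map_key (Perm.apply \<sigma>) n"
  show "m = n"
  proof (rule poly_mapping_eqI)
    fix i
    obtain k where "i = Perm.apply \<sigma> k"
      using bij_apply[of \<sigma>] by (meson bij_pointE)
    then show "Poly_Mapping.lookup m i = Poly_Mapping.lookup n i"
      using eq by (metis lookup_map_key_perm)
  qed
qed

lemma lookup_pperm:
  "Poly_Mapping.lookup (pperm \<sigma> f) m
    = Poly_Mapping.lookup f (Poly_Mapping.map_key (Perm.apply \<sigma>) m)"
  by (simp add: pperm_def map_key.rep_eq inj_map_key_perm)

lemma pperm_one: "pperm 1 f = f"
proof (rule poly_mapping_eqI)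
  fix m :: "'a \<Rightarrow>\<^sub>0 nat"
  have "Poly_Mapping.map_key (Perm.apply 1) m = m"
    by (rule poly_mapping_eqI) (simp add: lookup_map_key_perm del: apply_one, simp)
  then show "Poly_Mapping.lookup (pperm 1 f) m = Poly_Mapping.lookup f m"
    by (simp add: lookup_pperm)
qed

lemma pperm_pperm: "pperm \<sigma> (pperm \<tau> f) = pperm (\<sigma> * \<tau>) f"
proof (rule poly_mapping_eqI)
  fix m :: "'a \<Rightarrow>\<^sub>0 nat"
  have "Poly_Mapping.map_key (Perm.apply \<tau>) (Poly_Mapping.map_key (Perm.apply \<sigma>) m)
      = Poly_Mapping.map_key (Perm.apply (\<sigma> * \<tau>)) m"
    by (rule poly_mapping_eqI) (simp add: lookup_map_key_perm apply_sequence)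
  then show "Poly_Mapping.lookup (pperm \<sigma> (pperm \<tau> f)) m
      = Poly_Mapping.lookup (pperm (\<sigma> * \<tau>) f) m"
    by (simp add: lookup_pperm)
qed

lemma perm_right_inverse: "\<sigma> * inverse \<sigma> = (1 :: 'n perm)"
  by (rule perm_eqI) (simp add: apply_times apply_inverse bij_is_surj surj_f_inv_f)

lemma perm_inverse_times: "inverse (\<sigma> * \<tau>) = inverse \<tau> * inverse (\<sigma> :: 'n perm)"
  by (rule perm_eqI) (simp add: apply_times apply_inverse o_inv_distrib[symmetric] flip: apply_sequence)

lemma pperm_inverse [simp]:
  "pperm \<sigma> (pperm (inverse \<sigma>) f) = f" "pperm (inverse \<sigma>) (pperm \<sigma> f) = f"
  by (simp_all add: pperm_pperm perm_right_inverse pperm_one)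

lemma pperm_add: "pperm \<sigma> (f + g) = pperm \<sigma> f + pperm \<sigma> g"
  by (rule poly_mapping_eqI) (simp add: lookup_pperm lookup_add)

lemma pperm_pscale: "pperm \<sigma> (pscale c f) = pscale c (pperm \<sigma> f)"
  by (rule poly_mapping_eqI) (simp add: lookup_pperm lookup_pscale)

lemma pperm_pvar_mult: "pperm \<sigma> (pvar j * f) = pvar (Perm.apply \<sigma> j) * pperm \<sigma> f"
proof (rule poly_mapping_eqI)
  fix m :: "'a \<Rightarrow>\<^sub>0 nat"
  have "Poly_Mapping.map_key (Perm.apply \<sigma>) (m - Poly_Mapping.single (Perm.apply \<sigma> j) 1)
      = Poly_Mapping.map_key (Perm.apply \<sigma>) m - Poly_Mapping.single j 1"
    by (rule poly_mapping_eqI)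
      (simp add: lookup_map_key_perm lookup_minus lookup_single when_def apply_inj)
  then show "Poly_Mapping.lookup (pperm \<sigma> (pvar j * f)) m
      = Poly_Mapping.lookup (pvar (Perm.apply \<sigma> j) * pperm \<sigma> f) m"
    by (simp add: lookup_pperm lookup_pvar_mult lookup_map_key_perm)
qed

lemma pperm_pderiv_var:
  "pperm \<sigma> (pderiv_var j f) = pderiv_var (Perm.apply \<sigma> j) (pperm \<sigma> f)"
proof (rule poly_mapping_eqI)
  fix m :: "'a \<Rightarrow>\<^sub>0 nat"
  have "Poly_Mapping.map_key (Perm.apply \<sigma>) (m + Poly_Mapping.single (Perm.apply \<sigma> j) 1)
      = Poly_Mapping.map_key (Perm.apply \<sigma>) m + Poly_Mapping.single j 1"
    by (rule poly_mapping_eqI)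
      (simp add: lookup_map_key_perm lookup_add lookup_single when_def apply_inj)
  then show "Poly_Mapping.lookup (pperm \<sigma> (pderiv_var j f)) m
      = Poly_Mapping.lookup (pderiv_var (Perm.apply \<sigma> j) (pperm \<sigma> f)) m"
    by (simp add: lookup_pperm pderiv_var.rep_eq lookup_map_key_perm)
qed

lemma weyl_ops_conj:
  "A \<in> weyl_ops \<Longrightarrow> (\<lambda>f. pperm \<sigma> (A (pperm (inverse \<sigma>) f))) \<in> weyl_ops"
proof (induction rule: weyl_ops.induct)
  case (comp A B)
  from weyl_ops.comp[OF comp.IH] show ?case by simp
qed (simp_all add: pperm_pvar_mult pperm_pderiv_var pperm_add pperm_pscale weyl_ops.intros)

text \<open>
  The symmetric group acts on operators by conjugation with the substitution. The lemmas below
  show that this is the action by algebra automorphisms permuting the variables and the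
  derivatives simultaneously; it is determined by these properties.
\<close>

lift_definition weyl_act :: "'n perm \<Rightarrow> 'n weyl \<Rightarrow> 'n weyl"
  is "\<lambda>\<sigma> A f. pperm \<sigma> (A (pperm (inverse \<sigma>) f))" by (rule weyl_ops_conj)

lemma weyl_act_Z: "weyl_act \<sigma> (weyl_Z j) = weyl_Z (Perm.apply \<sigma> j)"
  by transfer (simp add: pperm_pvar_mult)

lemma weyl_act_D: "weyl_act \<sigma> (weyl_D j) = weyl_D (Perm.apply \<sigma> j)"
  by transfer (simp add: pperm_pderiv_var fun_eq_iff)

lemma weyl_act_hom:
  "weyl_act \<sigma> 1 = 1"
  "weyl_act \<sigma> (a + b) = weyl_act \<sigma> a + weyl_act \<sigma> b"
  "weyl_act \<sigma> (a * b) = weyl_act \<sigma> a * weyl_act \<sigma> b"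
  "weyl_act \<sigma> (weyl_scale c a) = weyl_scale c (weyl_act \<sigma> a)"
  by (transfer; simp add: pperm_add pperm_pscale)+

lemma weyl_act_one: "weyl_act 1 a = a"
  by transfer (simp add: pperm_one)

lemma weyl_act_times: "weyl_act (\<sigma> * \<tau>) a = weyl_act \<sigma> (weyl_act \<tau> a)"
  by transfer (simp add: pperm_pperm perm_inverse_times)

definition weyl_invariants :: "'n weyl set"
  where "weyl_invariants = {a. \<forall>\<sigma>. weyl_act \<sigma> a = a}"

definition weyl_subalgebra :: "'n weyl set \<Rightarrow> bool"
  where "weyl_subalgebra S \<longleftrightarrow> weyl.subspace S \<and> 1 \<in> S \<and> (\<forall>a\<in>S. \<forall>b\<in>S. a * b \<in> S)"

lemma weyl_subalgebra_hull: "weyl_subalgebra (weyl_subalgebra hull X)"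
  by (rule hull_in) (auto simp: weyl_subalgebra_def weyl.subspace_def)

lemma weyl_act_zero: "weyl_act \<sigma> 0 = 0"
  using weyl_act_hom(2)[of \<sigma> 0 0] by simp

lemma weyl_subalgebra_invariants: "weyl_subalgebra weyl_invariants"
  by (auto simp: weyl_subalgebra_def weyl.subspace_def weyl_invariants_def weyl_act_zero weyl_act_hom)

lemma weyl_generated:
  "weyl_subalgebra hull (range weyl_Z \<union> range weyl_D) = UNIV"
proof -
  let ?H = "weyl_subalgebra hull (range weyl_Z \<union> range weyl_D)"
  have H: "weyl_subalgebra ?H" and gen: "range weyl_Z \<union> range weyl_D \<subseteq> ?H"
    by (rule weyl_subalgebra_hull, rule hull_subset)
  have sub: "weyl.subspace ?H" and unit: "1 \<in> ?H"
    and closed: "\<And>a b. a \<in> ?H \<Longrightarrow> b \<in> ?H \<Longrightarrow> a * b \<in> ?H"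
    using iffD1[OF weyl_subalgebra_def H] by blast+
  have "Abs_weyl A \<in> ?H" if "A \<in> weyl_ops" for A
    using that
  proof (induction rule: weyl_ops.induct)
    case (var j)
    then show ?case using gen by (auto simp: weyl_Z_def)
  next
    case (deriv j)
    then show ?case using gen by (auto simp: weyl_D_def)
  next
    case one
    then show ?case using unit by (simp add: one_weyl_def)
  next
    case (scale A c)
    then have "Abs_weyl (\<lambda>f. pscale c (A f)) = weyl_scale c (Abs_weyl A)"
      by (simp add: weyl_scale_def Abs_weyl_inverse)
    with weyl.subspace_scale[OF sub scale.IH] show ?case by simp
  next
    case (add A B)
    then have "Abs_weyl (\<lambda>f. A f + B f) = Abs_weyl A + Abs_weyl B"
      by (simp add: plus_weyl_def Abs_weyl_inverse)
    with weyl.subspace_add[OF sub add.IH] show ?case by simp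
  next
    case (comp A B)
    then have "Abs_weyl (\<lambda>f. A (B f)) = Abs_weyl A * Abs_weyl B"
      by (simp add: times_weyl_def Abs_weyl_inverse)
    with closed[OF comp.IH] show ?case by simp
  qed
  then show ?thesis by (metis Abs_weyl_cases UNIV_eq_I)
qed

end

theory Submission
  imports Defs
begin

text \<open>
  Let \<open>S\<close> be the generated subalgebra and \<open>k\<close> the number of variables. Commutators of power
  sums are power sums of one-variable commutators. Hence, for \<open>k \<ge> 2\<close>, bracketing with
  \<open>\<Sum> z\<^sub>j\<close> and then with \<open>\<Sum> \<partial>\<^sub>j\<close> lowers the exponents of the generators, and bracketing with
  \<open>\<Sum> \<partial>\<^sub>j\<^sup>2\<close> trades a factor \<open>z\<close> for a factor \<open>\<partial>\<close>. If \<open>k \<ge> 3\<close>, this also yields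
  \<open>\<Sum> z\<^sub>j\<^sup>2 \<partial>\<^sub>j\<close>, which raises exponents of \<open>z\<close>, so \<open>S\<close> contains all \<open>\<Sum> z\<^sub>j\<^sup>a \<partial>\<^sub>j\<^sup>b\<close>.
  By polarization (multiplying a symmetrized product of one-variable operators by a power sum
  adds one factor, up to products of fewer factors) these generate all invariants. If \<open>k = 2\<close>,
  the quadratic invariants suffice, because the transposition only changes the signs of
  \<open>z\<^sub>1 - z\<^sub>2\<close> and \<open>\<partial>\<^sub>1 - \<partial>\<^sub>2\<close>.
\<close>

section \<open>Subalgebras\<close>

context
  fixes S :: "'n weyl set"
  assumes S: "weyl_subalgebra S"
begin

lemma subalg_subspace: "weyl.subspace S"
  using S by (simp add: weyl_subalgebra_def)

lemmas subalg_add = weyl.subspace_add[OF subalg_subspace]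
  and subalg_diff = weyl.subspace_diff[OF subalg_subspace]
  and subalg_scale = weyl.subspace_scale[OF subalg_subspace]
  and subalg_zero = weyl.subspace_0[OF subalg_subspace]
  and subalg_sum = weyl.subspace_sum[OF subalg_subspace]

lemma subalg_one: "1 \<in> S"
  using S by (simp add: weyl_subalgebra_def)

lemma subalg_mult: "a \<in> S \<Longrightarrow> b \<in> S \<Longrightarrow> a * b \<in> S"
  using S by (simp add: weyl_subalgebra_def)

lemma subalg_of_nat: "of_nat m \<in> S"
  by (induction m) (auto intro: subalg_zero subalg_add subalg_one)

text \<open>Multiplying by the ring element \<open>of_nat m\<close> is scaling by the complex number
  m, which is invertible for m > 0. Commutator identities can thus be divided by their integer
  coefficients.\<close>

lemma subalg_of_nat_cancel:
  assumes "of_nat m * a \<in> S" "m > 0"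
  shows "a \<in> S"
proof -
  have "of_nat m * a = weyl_scale (of_nat m) a"
    by (induction m) (simp_all add: distrib_right weyl.scale_left_distrib)
  then have "weyl_scale (inverse (of_nat m)) (weyl_scale (of_nat m) a) \<in> S"
    using assms(1) subalg_scale by metis
  then show ?thesis
    using assms(2) by simp
qed

end

text \<open>Lets stability of a subspace under the whole Weyl algebra be checked on generators only.
  Closure under products is associativity: m (a b) = (m a) b.\<close>

lemma right_multipliers_subalgebra:
  assumes "weyl.subspace M"
  shows "weyl_subalgebra {g. \<forall>m\<in>M. m * g \<in> M}"
  unfolding weyl_subalgebra_def weyl.subspace_def
proof (intro conjI ballI allI CollectI; (elim CollectE)?)
  fix a b :: "'a weyl" and m and c :: complex
  assume m: "m \<in> M"
  show "m * 0 \<in> M" "m * 1 \<in> M"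
    using m weyl.subspace_0[OF assms] by simp_all
  assume a: "\<forall>m\<in>M. m * a \<in> M"
  show "m * weyl_scale c a \<in> M"
    using a m weyl.subspace_scale[OF assms] by (simp add: weyl_scale_mult)
  assume b: "\<forall>m\<in>M. m * b \<in> M"
  show "m * (a + b) \<in> M"
    using a b m weyl.subspace_add[OF assms] by (simp add: distrib_left)
  show "m * (a * b) \<in> M"
    using a b m by (simp flip: mult.assoc)
qed

lemma left_multipliers_subalgebra:
  assumes "weyl.subspace M"
  shows "weyl_subalgebra {g. \<forall>m\<in>M. g * m \<in> M}"
  unfolding weyl_subalgebra_def weyl.subspace_def
proof (intro conjI ballI allI CollectI; (elim CollectE)?)
  fix a b :: "'a weyl" and m and c :: complex
  assume m: "m \<in> M"
  show "0 * m \<in> M" "1 * m \<in> M"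
    using m weyl.subspace_0[OF assms] by simp_all
  assume a: "\<forall>m\<in>M. a * m \<in> M"
  show "weyl_scale c a * m \<in> M"
    using a m weyl.subspace_scale[OF assms] by (simp add: weyl_scale_mult)
  assume b: "\<forall>m\<in>M. b * m \<in> M"
  show "(a + b) * m \<in> M"
    using a b m weyl.subspace_add[OF assms] by (simp add: distrib_right)
  show "a * b * m \<in> M"
    using a b m by (simp add: mult.assoc)
qed

lemma weyl_subalgebra_eq_UNIV:
  assumes "weyl_subalgebra S" "\<And>j. weyl_Z j \<in> S" "\<And>j. weyl_D j \<in> S"
  shows "a \<in> S"
proof -
  have "weyl_subalgebra hull (range weyl_Z \<union> range weyl_D) \<subseteq> S"
    using assms by (intro hull_minimal) auto
  then show ?thesis
    unfolding weyl_generated by blast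
qed

section \<open>Commutation relations\<close>

lemma weyl_Z_commute: "weyl_Z i * weyl_Z j = weyl_Z j * weyl_Z i"
  by transfer (simp add: mult.left_commute)

lemma weyl_D_commute: "weyl_D i * weyl_D j = weyl_D j * weyl_D i"
proof (cases "i = j")
  case False
  then have "pderiv_var i (pderiv_var j f) = pderiv_var j (pderiv_var i f)" for f :: "'a cpoly"
    by (intro poly_mapping_eqI)
      (simp add: pderiv_var.rep_eq lookup_add lookup_single add_ac mult.left_commute)
  then show ?thesis
    by transfer simp
qed simp

lemma weyl_D_Z_neq: "i \<noteq> j \<Longrightarrow> weyl_D i * weyl_Z j = weyl_Z j * weyl_D i"
  using weyl_D_Z[of i j] by simp

lemma weyl_D_Z_same: "weyl_D j * weyl_Z j = weyl_Z j * weyl_D j + 1"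
  using weyl_D_Z[of j j] by (simp add: algebra_simps)

lemma weyl_D_Z_power:
  "weyl_D j * weyl_Z j ^ a = weyl_Z j ^ a * weyl_D j + of_nat a * weyl_Z j ^ (a - 1)"
proof (induction a)
  case (Suc a)
  have *: "weyl_Z j * (of_nat a * weyl_Z j ^ (a - 1)) = of_nat a * weyl_Z j ^ a"
    by (cases a) (simp_all del: of_nat_Suc add: mult_of_nat_commute mult.assoc power_commutes)
  have "weyl_D j * weyl_Z j ^ Suc a = weyl_Z j * (weyl_D j * weyl_Z j ^ a) + weyl_Z j ^ a"
    by (simp add: weyl_D_Z_same distrib_right flip: mult.assoc)
  also have "\<dots> = weyl_Z j ^ Suc a * weyl_D j + of_nat (Suc a) * weyl_Z j ^ a"
    unfolding Suc.IH distrib_left * by (simp add: distrib_right add_ac mult.assoc)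
  finally show ?case
    by simp
qed simp

lemma weyl_D_power_Z:
  "weyl_D j ^ b * weyl_Z j = weyl_Z j * weyl_D j ^ b + of_nat b * weyl_D j ^ (b - 1)"
proof (induction b)
  case (Suc b)
  have *: "weyl_D j * (of_nat b * weyl_D j ^ (b - 1)) = of_nat b * weyl_D j ^ b"
    by (cases b) (simp_all del: of_nat_Suc add: mult_of_nat_commute mult.assoc power_commutes)
  have "weyl_D j ^ Suc b * weyl_Z j = weyl_D j * (weyl_D j ^ b * weyl_Z j)"
    by (simp add: mult.assoc)
  also have "\<dots> = weyl_Z j * weyl_D j ^ Suc b + of_nat (Suc b) * weyl_D j ^ b"
    unfolding Suc.IH distrib_left * by (simp add: distrib_right add_ac weyl_D_Z_same flip: mult.assoc)
  finally show ?case
    by simp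
qed simp

text \<open>The Leibniz rule, applied twice. For a = 0 the truncated exponent \<open>a - 1\<close>
  does no harm, since its coefficient \<open>Suc a * a\<close> vanishes.\<close>

lemma weyl_D2_monomial:
  "weyl_D j ^ 2 * (weyl_Z j ^ Suc a * weyl_D j ^ b) =
    weyl_Z j ^ Suc a * weyl_D j ^ b * weyl_D j ^ 2
    + (of_nat (2 * Suc a) * (weyl_Z j ^ a * weyl_D j ^ Suc b)
      + of_nat (Suc a * a) * (weyl_Z j ^ (a - 1) * weyl_D j ^ b))"
proof -
  let ?Z = "weyl_Z j" and ?D = "weyl_D j"
  have "?D ^ 2 * ?Z ^ Suc a = ?D * (?D * ?Z ^ Suc a)"
    by (simp add: power2_eq_square mult.assoc)
  also have "\<dots> = ?D * ?Z ^ Suc a * ?D + of_nat (Suc a) * (?D * ?Z ^ a)"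
  proof -
    have "?D * (?D * ?Z ^ Suc a) = ?D * (?Z ^ Suc a * ?D + of_nat (Suc a) * ?Z ^ a)"
      by (simp only: weyl_D_Z_power[of j "Suc a"] diff_Suc_1)
    moreover have "?D * (of_nat (Suc a) * ?Z ^ a) = of_nat (Suc a) * (?D * ?Z ^ a)"
      by (metis mult.assoc mult_of_nat_commute)
    ultimately show ?thesis
      by (simp only: distrib_left mult.assoc)
  qed
  also have "\<dots> = ?Z ^ Suc a * ?D ^ 2 + of_nat (Suc a) * (?Z ^ a * ?D)
      + (of_nat (Suc a) * (?Z ^ a * ?D) + of_nat (Suc a * a) * ?Z ^ (a - 1))"
    unfolding weyl_D_Z_power diff_Suc_1 distrib_left distrib_right power2_eq_square of_nat_mult
    by (simp only: mult.assoc)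
  also have "\<dots> = ?Z ^ Suc a * ?D ^ 2 + (of_nat (2 * Suc a) * (?Z ^ a * ?D)
      + of_nat (Suc a * a) * ?Z ^ (a - 1))"
    by (simp only: mult_2 of_nat_add distrib_right add_ac)
  finally have "?D ^ 2 * ?Z ^ Suc a * ?D ^ b = (?Z ^ Suc a * ?D ^ 2
      + (of_nat (2 * Suc a) * (?Z ^ a * ?D) + of_nat (Suc a * a) * ?Z ^ (a - 1))) * ?D ^ b"
    by simp
  also have "\<dots> = ?Z ^ Suc a * (?D ^ 2 * ?D ^ b) + (of_nat (2 * Suc a) * (?Z ^ a * (?D * ?D ^ b))
      + of_nat (Suc a * a) * (?Z ^ (a - 1) * ?D ^ b))"
    by (simp only: distrib_right mult.assoc)
  also have "?D ^ 2 * ?D ^ b = ?D ^ b * ?D ^ 2"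
    by (simp only: add.commute flip: power_add)
  finally show ?thesis
    by (simp only: mult.assoc power_Suc)
qed

section \<open>Words in one variable and its derivative\<close>

text \<open>Unlike normally ordered monomials, words are closed under multiplication: a product of
  two words in the same variable is one word, without correction terms.\<close>

definition weyl_word :: "bool list \<Rightarrow> 'n \<Rightarrow> 'n weyl"
  where "weyl_word w j = prod_list (map (\<lambda>x. if x then weyl_Z j else weyl_D j) w)"

lemma weyl_word_simps [simp]:
  "weyl_word [] j = 1"
  "weyl_word (x # w) j = (if x then weyl_Z j else weyl_D j) * weyl_word w j"
  "weyl_word (v @ w) j = weyl_word v j * weyl_word w j"
  by (simp_all add: weyl_word_def)

lemma weyl_word_monomial:
  "weyl_Z j ^ a * weyl_D j ^ b = weyl_word (replicate a True @ replicate b False) j"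
proof -
  have "weyl_Z j ^ a = weyl_word (replicate a True) j" "weyl_D j ^ b = weyl_word (replicate b False) j"
    by (induction a, simp_all) (induction b, simp_all)
  then show ?thesis by simp
qed

lemma weyl_word_commute:
  assumes "i \<noteq> j"
  shows "weyl_word v i * weyl_word w j = weyl_word w j * weyl_word v i"
proof -
  have gen: "(if x then weyl_Z i else weyl_D i) * weyl_word w j
      = weyl_word w j * (if x then weyl_Z i else weyl_D i)" for x
  proof (induction w)
    case (Cons y w)
    let ?g = "\<lambda>x i. if x then weyl_Z i else weyl_D i"
    have "?g x i * ?g y j = ?g y j * ?g x i"
      using assms by (auto simp: weyl_Z_commute weyl_D_commute weyl_D_Z_neq)
    then have "?g x i * (?g y j * weyl_word w j) = ?g y j * (?g x i * weyl_word w j)"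
      by (metis mult.assoc)
    with Cons.IH show ?case
      by (simp only: weyl_word_simps mult.assoc)
  qed simp
  show ?thesis
  proof (induction v)
    case (Cons x v)
    then show ?case
      using gen[of x] by (simp only: weyl_word_simps) (metis mult.assoc)
  qed simp
qed

lemma weyl_monomial_commute:
  "i \<noteq> j \<Longrightarrow> weyl_Z i ^ a * weyl_D i ^ b * (weyl_Z j ^ c * weyl_D j ^ d)
    = weyl_Z j ^ c * weyl_D j ^ d * (weyl_Z i ^ a * weyl_D i ^ b)"
  unfolding weyl_word_monomial by (rule weyl_word_commute)

section \<open>Power sums\<close>

text \<open>In the double sums the terms with i \<noteq> j cancel, and only the diagonal is
  left.\<close>

lemma sum_mult_commutator:
  fixes v w :: "'n::finite \<Rightarrow> 'a::ring"
  assumes "\<And>i j. i \<noteq> j \<Longrightarrow> v i * w j = w j * v i"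
  shows "(\<Sum>i\<in>UNIV. v i) * (\<Sum>j\<in>UNIV. w j) - (\<Sum>j\<in>UNIV. w j) * (\<Sum>i\<in>UNIV. v i)
    = (\<Sum>j\<in>UNIV. v j * w j - w j * v j)"
proof -
  have "(\<Sum>j\<in>UNIV. w j) * (\<Sum>i\<in>UNIV. v i) = (\<Sum>i\<in>UNIV. \<Sum>j\<in>UNIV. w j * v i)"
    unfolding sum_product by (rule sum.swap)
  then have "(\<Sum>i\<in>UNIV. v i) * (\<Sum>j\<in>UNIV. w j) - (\<Sum>j\<in>UNIV. w j) * (\<Sum>i\<in>UNIV. v i)
      = (\<Sum>i\<in>UNIV. \<Sum>j\<in>UNIV. v i * w j - w j * v i)"
    by (simp add: sum_product sum_subtractf)
  also have "\<dots> = (\<Sum>i\<in>UNIV. \<Sum>j\<in>UNIV. if j = i then v i * w i - w i * v i else 0)"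
    by (intro sum.cong refl) (use assms in auto)
  finally show ?thesis by simp
qed

context
  fixes S :: "'n::finite weyl set"
  assumes S: "weyl_subalgebra S"
begin

text \<open>Common form of the bracket arguments: the commutator of two sums in \<open>S\<close> is
  c times the wanted sum plus d times a sum known to lie in \<open>S\<close>; subtract the latter
  and divide by c.\<close>

lemma subalg_commutator_step:
  fixes u v w r :: "'n \<Rightarrow> 'n weyl"
  assumes vw: "(\<Sum>j\<in>UNIV. v j) \<in> S" "(\<Sum>j\<in>UNIV. w j) \<in> S" and r: "(\<Sum>j\<in>UNIV. r j) \<in> S"
    and commute: "\<And>i j. i \<noteq> j \<Longrightarrow> v i * w j = w j * v i"
    and step: "\<And>j. v j * w j = w j * v j + (of_nat c * u j + of_nat d * r j)" and "c > 0"
  shows "(\<Sum>j\<in>UNIV. u j) \<in> S"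
proof -
  let ?v = "\<Sum>j\<in>UNIV. v j" and ?w = "\<Sum>j\<in>UNIV. w j"
  have "?v * ?w - ?w * ?v = of_nat c * (\<Sum>j\<in>UNIV. u j) + of_nat d * (\<Sum>j\<in>UNIV. r j)"
    using sum_mult_commutator[of v w, OF commute] by (simp add: step sum.distrib sum_distrib_left)
  then have "of_nat c * (\<Sum>j\<in>UNIV. u j) = ?v * ?w - ?w * ?v - of_nat d * (\<Sum>j\<in>UNIV. r j)"
    by (simp add: algebra_simps)
  also have "\<dots> \<in> S"
    by (intro subalg_diff[OF S] subalg_mult[OF S] subalg_of_nat[OF S] vw r)
  finally show ?thesis
    by (rule subalg_of_nat_cancel[OF S _ \<open>c > 0\<close>])
qed

lemma subalg_commutator_step0:
  fixes u v w :: "'n \<Rightarrow> 'n weyl"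
  assumes "(\<Sum>j\<in>UNIV. v j) \<in> S" "(\<Sum>j\<in>UNIV. w j) \<in> S"
    and "\<And>i j. i \<noteq> j \<Longrightarrow> v i * w j = w j * v i"
    and "\<And>j. v j * w j = w j * v j + of_nat c * u j" and "c > 0"
  shows "(\<Sum>j\<in>UNIV. u j) \<in> S"
  using subalg_commutator_step[of v w "\<lambda>_. 0" c u 0] assms subalg_zero[OF S] by simp

section \<open>Lowering, trading and raising exponents of power sums\<close>

context
  fixes k :: nat
  assumes k: "k \<ge> 2"
    and Z1: "(\<Sum>j\<in>UNIV. weyl_Z j) \<in> S"
    and Zk: "(\<Sum>j\<in>UNIV. weyl_Z j ^ k) \<in> S"
    and Dk: "(\<Sum>j\<in>UNIV. weyl_D j ^ k) \<in> S"
begin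

text \<open>Descent from the exponent k, by [\<partial>^(b+1), z] = (b+1) \<partial>^b.\<close>

lemma subalg_D_power: "b \<le> k \<Longrightarrow> (\<Sum>j\<in>UNIV. weyl_D j ^ b) \<in> S"
proof (induction rule: inc_induct)
  case (step b)
  show ?case
  proof (rule subalg_commutator_step0[OF step.IH Z1])
    show "weyl_D i ^ Suc b * weyl_Z j = weyl_Z j * weyl_D i ^ Suc b" if "i \<noteq> j" for i j :: 'n
      using weyl_monomial_commute[OF that, of 0 "Suc b" 1 0] by simp
    show "weyl_D j ^ Suc b * weyl_Z j = weyl_Z j * weyl_D j ^ Suc b + of_nat (Suc b) * weyl_D j ^ b"
      for j :: 'n
      using weyl_D_power_Z[of j "Suc b"] by simp
  qed simp
qed (rule Dk)

lemma subalg_D1: "(\<Sum>j\<in>UNIV. weyl_D j) \<in> S"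
  using subalg_D_power[of 1] k by simp

lemma subalg_Z_power: "a \<le> k \<Longrightarrow> (\<Sum>j\<in>UNIV. weyl_Z j ^ a) \<in> S"
proof (induction rule: inc_induct)
  case (step a)
  show ?case
  proof (rule subalg_commutator_step0[OF subalg_D1 step.IH])
    show "weyl_D i * weyl_Z j ^ Suc a = weyl_Z j ^ Suc a * weyl_D i" if "i \<noteq> j" for i j :: 'n
      using weyl_monomial_commute[OF that, of 0 1 "Suc a" 0] by simp
    show "weyl_D j * weyl_Z j ^ Suc a = weyl_Z j ^ Suc a * weyl_D j + of_nat (Suc a) * weyl_Z j ^ a"
      for j :: 'n
      using weyl_D_Z_power[of j "Suc a"] by simp
  qed simp
qed (rule Zk)

text \<open>Bracketing the first sum with the sum of the \<partial>^2 gives 2(a+1) times the wanted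
  sum; the second hypothesis absorbs the lower-order term of the normal ordering.\<close>

lemma subalg_shift_degree:
  assumes "(\<Sum>j\<in>UNIV. weyl_Z j ^ Suc a * weyl_D j ^ b) \<in> S"
    and "(\<Sum>j\<in>UNIV. weyl_Z j ^ (a - 1) * weyl_D j ^ b) \<in> S"
  shows "(\<Sum>j\<in>UNIV. weyl_Z j ^ a * weyl_D j ^ Suc b) \<in> S"
proof (rule subalg_commutator_step[OF subalg_D_power[OF k] assms])
  show "weyl_D i ^ 2 * (weyl_Z j ^ Suc a * weyl_D j ^ b)
      = weyl_Z j ^ Suc a * weyl_D j ^ b * weyl_D i ^ 2" if "i \<noteq> j" for i j :: 'n
    using weyl_monomial_commute[OF that, of 0 2 "Suc a" b] by simp
  show "weyl_D j ^ 2 * (weyl_Z j ^ Suc a * weyl_D j ^ b) =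
      weyl_Z j ^ Suc a * weyl_D j ^ b * weyl_D j ^ 2
      + (of_nat (2 * Suc a) * (weyl_Z j ^ a * weyl_D j ^ Suc b)
        + of_nat (Suc a * a) * (weyl_Z j ^ (a - 1) * weyl_D j ^ b))" for j :: 'n
    by (rule weyl_D2_monomial)
qed simp

lemma subalg_ZD: "(\<Sum>j\<in>UNIV. weyl_Z j * weyl_D j) \<in> S"
  using subalg_shift_degree[of 1 0] subalg_Z_power[of 2] subalg_Z_power[of 0] k
  by (simp add: numeral_2_eq_2)

lemma subalg_monomial:
  assumes "k \<ge> 3"
  shows "(\<Sum>j\<in>UNIV. weyl_Z j ^ a * weyl_D j ^ b) \<in> S"
proof (induction b arbitrary: a)
  case 0
  \<comment> \<open>Here k \<ge> 3 enters: the sum of the z^3 is available, and one factor z is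
    traded for \<partial>.\<close>
  have Z2D: "(\<Sum>j\<in>UNIV. weyl_Z j ^ 2 * weyl_D j) \<in> S"
    using subalg_shift_degree[of 2 0] subalg_Z_power[of 3] subalg_Z_power[of 1] assms
    by (simp add: eval_nat_numeral)
  \<comment> \<open>Since [z^2 \<partial>, z^n] = n z^(n+1), exponents of z can be raised without
    bound, starting from n = 2.\<close>
  have "(\<Sum>j\<in>UNIV. weyl_Z j ^ Suc (Suc a)) \<in> S" for a
  proof (induction a)
    case 0
    then show ?case
      using subalg_Z_power[OF k] by (simp add: numeral_2_eq_2)
  next
    case (Suc a)
    show ?case
    proof (rule subalg_commutator_step0[OF Z2D Suc.IH])
      show "weyl_Z i ^ 2 * weyl_D i * weyl_Z j ^ Suc (Suc a)
          = weyl_Z j ^ Suc (Suc a) * (weyl_Z i ^ 2 * weyl_D i)" if "i \<noteq> j" for i j :: 'n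
        using weyl_monomial_commute[OF that, of 2 1 "Suc (Suc a)" 0] by simp
      show "weyl_Z j ^ 2 * weyl_D j * weyl_Z j ^ Suc (Suc a)
          = weyl_Z j ^ Suc (Suc a) * (weyl_Z j ^ 2 * weyl_D j)
            + of_nat (Suc (Suc a)) * weyl_Z j ^ Suc (Suc (Suc a))" for j :: 'n
      proof -
        let ?n = "Suc (Suc a)"
        have "weyl_Z j ^ 2 * weyl_D j * weyl_Z j ^ ?n
            = weyl_Z j ^ 2 * weyl_Z j ^ ?n * weyl_D j + weyl_Z j ^ 2 * (of_nat ?n * weyl_Z j ^ Suc a)"
          by (simp only: mult.assoc weyl_D_Z_power distrib_left diff_Suc_1)
        also have "weyl_Z j ^ 2 * weyl_Z j ^ ?n = weyl_Z j ^ ?n * weyl_Z j ^ 2"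
          by (simp only: add.commute flip: power_add)
        also have "weyl_Z j ^ 2 * (of_nat ?n * weyl_Z j ^ Suc a)
            = of_nat ?n * (weyl_Z j ^ 2 * weyl_Z j ^ Suc a)"
          by (metis mult.assoc mult_of_nat_commute)
        also have "weyl_Z j ^ 2 * weyl_Z j ^ Suc a = weyl_Z j ^ Suc ?n"
          by (simp flip: power_add power_Suc)
        finally show ?thesis
          by (simp only: mult.assoc)
      qed
    qed simp
  qed
  \<comment> \<open>Exponents up to k come from the descent; a larger one exceeds 2, so it equals
    \<open>Suc (Suc (a - 2))\<close>.\<close>
  from this[of "a - 2"] show ?case
    using subalg_Z_power[of a] k by (cases "a \<le> k") (simp_all flip: Suc_diff_le)
next
  case (Suc b)
  \<comment> \<open>The induction hypothesis covers every exponent of z, so it supplies both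
    \<open>Suc a\<close> and \<open>a - 1\<close>.\<close>
  then show ?case
    by (intro subalg_shift_degree)
qed

end

text \<open>Normal ordering, one letter at a time. The claim is strengthened by a monomial z^a
  \<partial>^b to the right of the word: a last letter z is absorbed into z^a, and a last letter
  \<partial> moves across z^a, leaving two terms with a shorter word.\<close>

lemma subalg_word_sum:
  assumes "\<And>a b. (\<Sum>j\<in>UNIV. weyl_Z j ^ a * weyl_D j ^ b) \<in> S"
  shows "(\<Sum>j\<in>UNIV. weyl_word w j) \<in> S"
proof -
  have "(\<Sum>j\<in>UNIV. weyl_word w j * (weyl_Z j ^ a * weyl_D j ^ b)) \<in> S" for a b
  proof (induction w arbitrary: a b rule: rev_induct)
    case Nil
    then show ?case by (simp add: assms)
  next
    case (snoc x w)
    show ?case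
    proof (cases x)
      case True
      then show ?thesis
        using snoc[of "Suc a" b] by (simp add: mult.assoc)
    next
      case False
      have *: "weyl_word w j * weyl_D j * (weyl_Z j ^ a * weyl_D j ^ b)
          = weyl_word w j * (weyl_Z j ^ a * weyl_D j ^ Suc b)
            + of_nat a * (weyl_word w j * (weyl_Z j ^ (a - 1) * weyl_D j ^ b))" for j :: 'n
      proof -
        have "weyl_D j * (weyl_Z j ^ a * weyl_D j ^ b)
            = weyl_Z j ^ a * weyl_D j ^ Suc b + of_nat a * (weyl_Z j ^ (a - 1) * weyl_D j ^ b)"
          using weyl_D_Z_power[of j a] by (simp add: distrib_right flip: mult.assoc)
        then show ?thesis
          by (simp add: mult.assoc distrib_left) (metis mult.assoc mult_of_nat_commute)
      qed
      have "(\<Sum>j::'n\<in>UNIV. weyl_word w j * weyl_D j * (weyl_Z j ^ a * weyl_D j ^ b))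
          = (\<Sum>j\<in>UNIV. weyl_word w j * (weyl_Z j ^ a * weyl_D j ^ Suc b))
            + of_nat a * (\<Sum>j\<in>UNIV. weyl_word w j * (weyl_Z j ^ (a - 1) * weyl_D j ^ b))"
        unfolding sum_distrib_left sum.distrib[symmetric] by (intro sum.cong refl *)
      also have "\<dots> \<in> S"
        by (intro subalg_add[OF S] subalg_mult[OF S] subalg_of_nat[OF S] snoc)
      finally show ?thesis
        using False by simp
    qed
  qed
  from this[of 0 0] show ?thesis by simp
qed

end

section \<open>Symmetrization\<close>

instance perm :: (finite) finite
proof
  have "inj (Perm.apply :: 'a perm \<Rightarrow> _)"
    by (rule injI) (simp add: apply_inject)
  then show "finite (UNIV :: 'a perm set)"
    by (rule finite_imageD[rotated]) simp
qed

text \<open>The Reynolds operator without its normalization; the group order is divided out only at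
  the end.\<close>

definition weyl_sym :: "'n::finite weyl \<Rightarrow> 'n weyl"
  where "weyl_sym a = (\<Sum>\<sigma>\<in>UNIV. weyl_act \<sigma> a)"

lemma weyl_act_sum: "weyl_act \<sigma> (sum f A) = (\<Sum>x\<in>A. weyl_act \<sigma> (f x))"
  by (induction A rule: infinite_finite_induct) (simp_all add: weyl_act_zero weyl_act_hom)

lemma weyl_sym_sum: "weyl_sym (sum f A) = (\<Sum>x\<in>A. weyl_sym (f x))"
  unfolding weyl_sym_def weyl_act_sum by (rule sum.swap)

lemma weyl_sym_add: "weyl_sym (a + b) = weyl_sym a + weyl_sym b"
  by (simp add: weyl_sym_def weyl_act_hom sum.distrib)

lemma weyl_sym_scale: "weyl_sym (weyl_scale c a) = weyl_scale c (weyl_sym a)"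
  by (simp add: weyl_sym_def weyl_act_hom weyl.scale_sum_right)

text \<open>Right translation by \<tau> permutes the group, so it only reindexes the sum.\<close>

lemma weyl_sym_act: "weyl_sym (weyl_act \<tau> a) = weyl_sym a"
proof -
  have "inj (\<lambda>\<sigma>. \<sigma> * \<tau>)"
    by (rule injI) (metis mult.assoc mult.right_neutral perm_right_inverse)
  then have "bij (\<lambda>\<sigma>. \<sigma> * \<tau>)"
    by (simp add: bij_betw_def finite_UNIV_inj_surj)
  then have "(\<Sum>\<sigma>\<in>UNIV. weyl_act (\<sigma> * \<tau>) a) = weyl_sym a"
    unfolding weyl_sym_def by (rule sum.reindex_bij_betw)
  then show ?thesis
    by (simp add: weyl_sym_def weyl_act_times)
qed

lemma weyl_sym_invariant_mult:
  "a \<in> weyl_invariants \<Longrightarrow> weyl_sym (a * b) = a * weyl_sym b"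
  by (simp add: weyl_sym_def weyl_act_hom weyl_invariants_def sum_distrib_left)

lemma weyl_sym_invariant:
  assumes "a \<in> weyl_invariants"
  shows "weyl_sym (a :: 'n::finite weyl) = of_nat (CARD('n perm)) * a"
  using assms by (simp add: weyl_sym_def weyl_invariants_def)

lemma weyl_act_word: "weyl_act \<sigma> (weyl_word w j) = weyl_word w (Perm.apply \<sigma> j)"
  by (induction w) (simp_all add: weyl_act_hom weyl_act_Z weyl_act_D)

lemma sum_invariant:
  fixes v :: "'n::finite \<Rightarrow> 'n weyl"
  assumes "\<And>\<sigma> j. weyl_act \<sigma> (v j) = v (Perm.apply \<sigma> j)"
  shows "(\<Sum>j\<in>UNIV. v j) \<in> weyl_invariants"
  by (simp add: weyl_invariants_def weyl_act_sum assms sum.reindex_bij_betw)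

section \<open>Polarization of products of one-variable words\<close>

definition words_prod :: "'n list \<Rightarrow> ('n \<Rightarrow> bool list) \<Rightarrow> 'n weyl"
  where "words_prod js u = prod_list (map (\<lambda>j. weyl_word (u j) j) js)"

lemma words_prod_simps [simp]:
  "words_prod [] u = 1"
  "words_prod (j # js) u = weyl_word (u j) j * words_prod js u"
  by (simp_all add: words_prod_def)

lemma words_prod_update_notin: "j \<notin> set js \<Longrightarrow> words_prod js (u(j := w)) = words_prod js u"
  by (induction js) auto

text \<open>The new word commutes past the factors of other variables until it meets the factor of
  its own variable, where it is prepended.\<close>

lemma word_mult_words_prod:
  assumes "distinct js" "j \<in> set js"
  shows "weyl_word w j * words_prod js u = words_prod js (u(j := w @ u j))"
  using assms
proof (induction js)
  case (Cons i js)
  show ?case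
  proof (cases "i = j")
    case True
    then show ?thesis
      using Cons.prems by (simp add: words_prod_update_notin mult.assoc del: fun_upd_apply add: fun_upd_same)
  next
    case False
    then have "weyl_word w j * (weyl_word (u i) i * words_prod js u)
        = weyl_word (u i) i * (weyl_word w j * words_prod js u)"
      by (metis mult.assoc weyl_word_commute)
    then show ?thesis
      using Cons False by simp
  qed
qed simp

lemma weyl_act_swap_words_prod:
  assumes "i \<notin> set js" "j \<notin> set js"
  shows "weyl_act (Perm.swap i j) (words_prod js u) = words_prod js u"
  using assms by (induction js) (auto simp: weyl_act_hom weyl_act_word)

text \<open>Induction on the number of factors: the product of a power sum with a shorter
  symmetrized product consists of symmetrized products in which the new word either merges with an
  old factor or occupies a new variable.\<close>

lemma weyl_sym_words_prod:
  fixes S :: "'n::finite weyl set"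
  assumes S: "weyl_subalgebra S" and word: "\<And>w. (\<Sum>j\<in>UNIV. weyl_word w j) \<in> S"
    and "distinct js"
  shows "weyl_sym (words_prod js u) \<in> S"
  using \<open>distinct js\<close>
proof (induction js arbitrary: u)
  case Nil
  have "(1 :: 'n weyl) \<in> weyl_invariants"
    by (simp add: weyl_invariants_def weyl_act_hom)
  from weyl_sym_invariant[OF this] show ?case
    using subalg_of_nat[OF S] by simp
next
  case (Cons i js)
  let ?t = "\<lambda>j. weyl_sym (weyl_word (u i) j * words_prod js u)"
  let ?P = "\<Sum>j\<in>UNIV. weyl_word (u i) j :: 'n weyl"
  \<comment> \<open>The word merges with the factor at j, so the induction hypothesis applies with a
    changed \<open>u\<close>.\<close>
  have inside: "?t j \<in> S" if "j \<in> set js" for j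
    using Cons that by (simp add: word_mult_words_prod)
  \<comment> \<open>The transposition of j and i fixes the old factors, as neither index occurs in
    \<open>js\<close>, and symmetrization does not see it.\<close>
  have outside: "?t j = ?t i" if "j \<in> - set js" for j
  proof -
    have "?t j = weyl_sym (weyl_act (Perm.swap j i) (weyl_word (u i) j * words_prod js u))"
      by (rule weyl_sym_act[symmetric])
    then show ?thesis
      using that Cons.prems
      by (simp add: weyl_act_hom weyl_act_word weyl_act_swap_words_prod)
  qed
  have "?P * weyl_sym (words_prod js u) = weyl_sym (?P * words_prod js u)"
    by (intro weyl_sym_invariant_mult[symmetric] sum_invariant weyl_act_word)
  also have "\<dots> = (\<Sum>j\<in>UNIV. ?t j)"
    by (simp add: sum_distrib_right weyl_sym_sum)
  also have "\<dots> = (\<Sum>j\<in>set js. ?t j) + (\<Sum>j\<in>- set js. ?t j)"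
    by (subst sum.union_disjoint[symmetric]) simp_all
  also have "(\<Sum>j\<in>- set js. ?t j) = of_nat (card (- set js)) * ?t i"
    using outside by simp
  finally have "of_nat (card (- set js)) * ?t i
      = ?P * weyl_sym (words_prod js u) - (\<Sum>j\<in>set js. ?t j)"
    by (simp add: algebra_simps)
  also have "\<dots> \<in> S"
    using Cons by (intro subalg_diff[OF S] subalg_mult[OF S] subalg_sum[OF S] word inside) simp_all
  \<comment> \<open>The multiplicity is positive because i itself lies outside
    \<open>js\<close>.\<close>
  finally have "?t i \<in> S"
    by (rule subalg_of_nat_cancel[OF S]) (use Cons.prems in \<open>auto simp: card_gt_0_iff\<close>)
  then show ?case by simp
qed

text \<open>The span contains 1 and is stable under left multiplication by one-letter words, that
  is, by the generators of the Weyl algebra.\<close>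

lemma words_prod_span:
  assumes "distinct js" "set js = UNIV"
  shows "weyl.span (range (words_prod js)) = UNIV"
proof -
  let ?M = "weyl.span (range (words_prod js))"
  have sub: "weyl_subalgebra {g. \<forall>m\<in>?M. g * m \<in> ?M}"
    by (rule left_multipliers_subalgebra) (rule weyl.subspace_span)
  have gen: "g * m \<in> ?M" if g: "g = weyl_word w j" and "m \<in> ?M" for g m w j
    using \<open>m \<in> ?M\<close>
  proof (induction rule: weyl.span_induct_alt)
    case base
    show ?case using weyl.span_zero by simp
  next
    case (step c x y)
    then obtain u where "x = words_prod js u" by blast
    then have "g * x \<in> ?M"
      using word_mult_words_prod[OF assms(1), of j w u] assms(2) g
      by (auto intro: weyl.span_base)
    with step.IH show ?case
      by (simp add: distrib_left weyl_scale_mult weyl.span_add weyl.span_scale)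
  qed
  have "a * m \<in> ?M" if "m \<in> ?M" for a m
    using weyl_subalgebra_eq_UNIV[OF sub, of a] gen[of _ "[True]"] gen[of _ "[False]"] that
    by simp
  moreover have "1 \<in> ?M"
  proof -
    have "words_prod js (\<lambda>_. []) = 1"
      by (induction js) simp_all
    then show ?thesis
      by (metis weyl.span_base rangeI)
  qed
  ultimately show ?thesis
    by (metis UNIV_eq_I mult.right_neutral)
qed

text \<open>Symmetrizing an expansion of an invariant into products of words lands in
  \<open>S\<close>, and it multiplies the invariant by the group order.\<close>

lemma invariants_subset_if_word_sums:
  fixes S :: "'n::finite weyl set"
  assumes S: "weyl_subalgebra S" and word: "\<And>w. (\<Sum>j\<in>UNIV. weyl_word w j) \<in> S"
  shows "weyl_invariants \<subseteq> S"
proof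
  fix a :: "'n weyl" assume a: "a \<in> weyl_invariants"
  obtain js :: "'n list" where js: "distinct js" "set js = UNIV"
    using finite_distinct_list[of "UNIV :: 'n set"] by auto
  have "a \<in> weyl.span (range (words_prod js))"
    by (simp add: words_prod_span[OF js])
  then have "weyl_sym a \<in> S"
  proof (induction rule: weyl.span_induct_alt)
    case base
    show ?case
      using subalg_zero[OF S] by (simp add: weyl_sym_def weyl_act_zero)
  next
    case (step c x y)
    then show ?case
      using weyl_sym_words_prod[OF S word js(1)]
      by (auto simp: weyl_sym_add weyl_sym_scale intro!: subalg_add[OF S] subalg_scale[OF S])
  qed
  then have "of_nat (CARD('n perm)) * a \<in> S"
    by (simp add: weyl_sym_invariant[OF a])
  then show "a \<in> S"
    by (rule subalg_of_nat_cancel[OF S]) simp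
qed

section \<open>Two variables\<close>

text \<open>
  With \<open>w = z\<^sub>1 - z\<^sub>2\<close> and \<open>q = \<partial>\<^sub>1 - \<partial>\<^sub>2\<close>, every operator has the form \<open>h + h' w + h'' q\<close> with
  \<open>h, h', h''\<close> in the subalgebra, and the transposition changes the sign of the last two terms.
\<close>

lemma invariants_subset_two_variables:
  fixes S :: "'n::finite weyl set"
  assumes S: "weyl_subalgebra S" and inv: "S \<subseteq> weyl_invariants" and card: "CARD('n) = 2"
    and s: "(\<Sum>j\<in>UNIV. weyl_Z j) \<in> S" and p: "(\<Sum>j\<in>UNIV. weyl_D j) \<in> S"
    and Z2: "(\<Sum>j\<in>UNIV. weyl_Z j ^ 2) \<in> S" and D2: "(\<Sum>j\<in>UNIV. weyl_D j ^ 2) \<in> S"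
    and ZD: "(\<Sum>j\<in>UNIV. weyl_Z j * weyl_D j) \<in> S"
  shows "weyl_invariants \<subseteq> S"
proof
  fix a :: "'n weyl" assume a: "a \<in> weyl_invariants"
  obtain i j :: 'n where ij: "UNIV = {i, j}" "i \<noteq> j"
    using card by (meson card_2_iff)
  have sum2: "(\<Sum>x\<in>UNIV. f x) = f i + f j" for f :: "'n \<Rightarrow> 'n weyl"
    unfolding ij(1) using ij(2) by simp
  define s p w q where "s = weyl_Z i + weyl_Z j" and "p = weyl_D i + weyl_D j"
    and "w = weyl_Z i - weyl_Z j" and "q = weyl_D i - weyl_D j"
  have sp: "s \<in> S" "p \<in> S"
    using s p by (simp_all add: sum2 s_def p_def)
  have Z: "weyl_Z j * weyl_Z i = weyl_Z i * weyl_Z j"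
    and D: "weyl_D j * weyl_D i = weyl_D i * weyl_D j"
    and DZ: "weyl_D i * weyl_Z j = weyl_Z j * weyl_D i" "weyl_D j * weyl_Z i = weyl_Z i * weyl_D j"
    using ij(2) by (simp_all add: weyl_Z_commute weyl_D_commute weyl_D_Z_neq)
  \<comment> \<open>In the mixed commutators the contributions of the two variables have opposite
    signs and cancel.\<close>
  have comm: "w * s = s * w" "w * p = p * w" "q * s = s * q" "q * p = p * q"
    by (simp_all add: s_def p_def w_def q_def algebra_simps Z D DZ weyl_D_Z_same)
  note two = subalg_of_nat[OF S, of 2, simplified]
  \<comment> \<open>Instances of (x - y)(x' - y') = 2 (x x' + y y') - (x + y)(x' + y').\<close>
  have eqs: "w * w = 2 * (weyl_Z i ^ 2 + weyl_Z j ^ 2) - s * s"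
    "q * q = 2 * (weyl_D i ^ 2 + weyl_D j ^ 2) - p * p"
    "w * q = 2 * (weyl_Z i * weyl_D i + weyl_Z j * weyl_D j) - s * p"
    by (simp_all add: s_def p_def w_def q_def algebra_simps Z D DZ power2_eq_square mult_2)
  have quad: "w * w \<in> S" "q * q \<in> S" "w * q \<in> S"
    unfolding eqs
    by (intro subalg_diff[OF S] subalg_mult[OF S] two sp Z2[unfolded sum2] D2[unfolded sum2]
        ZD[unfolded sum2])+
  have "q * w = w * q + 2"
    by (simp add: w_def q_def algebra_simps Z D DZ weyl_D_Z_same)
  then have qw: "q * w \<in> S"
    using subalg_add[OF S quad(3) two] by simp
  define M where "M = {h + h' * w + h'' * q | h h' h''. h \<in> S \<and> h' \<in> S \<and> h'' \<in> S}"
  have M: "h + h' * w + h'' * q \<in> M" if "h \<in> S" "h' \<in> S" "h'' \<in> S" for h h' h''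
    using that by (auto simp: M_def)
  have sub: "weyl.subspace M"
    unfolding weyl.subspace_def
  proof (intro conjI ballI allI)
    show "0 \<in> M"
      using M[of 0 0 0] subalg_zero[OF S] by simp
  next
    fix x y assume "x \<in> M" "y \<in> M"
    then obtain h h' h'' k k' k'' where x: "x = h + h' * w + h'' * q" "h \<in> S" "h' \<in> S" "h'' \<in> S"
      and y: "y = k + k' * w + k'' * q" "k \<in> S" "k' \<in> S" "k'' \<in> S"
      by (auto simp: M_def)
    then have "x + y = (h + k) + (h' + k') * w + (h'' + k'') * q"
      by (simp add: algebra_simps)
    then show "x + y \<in> M"
      using M[of "h + k" "h' + k'" "h'' + k''"] x(2-4) y(2-4) subalg_add[OF S] by metis
  next
    fix c x assume "x \<in> M"
    then obtain h h' h'' where x: "x = h + h' * w + h'' * q" "h \<in> S" "h' \<in> S" "h'' \<in> S"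
      by (auto simp: M_def)
    then show "weyl_scale c x \<in> M"
      using M[of "weyl_scale c h" "weyl_scale c h'" "weyl_scale c h''"] subalg_scale[OF S]
      by (simp add: weyl.scale_right_distrib weyl_scale_mult)
  qed
  define T where "T = {g. \<forall>m\<in>M. m * g \<in> M}"
  have T: "weyl_subalgebra T"
    unfolding T_def by (rule right_multipliers_subalgebra[OF sub])
  \<comment> \<open>Right multiplication by \<open>s\<close> or \<open>p\<close> keeps the shape
    because these commute with \<open>w\<close> and \<open>q\<close>; multiplication by
    \<open>w\<close> or \<open>q\<close> produces quadratic terms, which lie in
    \<open>S\<close>.\<close>
  have "s \<in> T" "p \<in> T" "w \<in> T" "q \<in> T"
    unfolding T_def
  proof safe
    fix m assume "m \<in> M"
    then obtain h h' h'' where m: "m = h + h' * w + h'' * q" and h: "h \<in> S" "h' \<in> S" "h'' \<in> S"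
      by (auto simp: M_def)
    have eqs: "m * s = h * s + h' * s * w + h'' * s * q" "m * p = h * p + h' * p * w + h'' * p * q"
      "m * w = (h' * (w * w) + h'' * (q * w)) + h * w + 0 * q"
      "m * q = (h' * (w * q) + h'' * (q * q)) + 0 * w + h * q"
      by (simp_all add: m distrib_right mult.assoc comm)
    show "m * s \<in> M" "m * p \<in> M" "m * w \<in> M" "m * q \<in> M"
      unfolding eqs
      by (intro M h sp quad qw subalg_mult[OF S] subalg_add[OF S] subalg_zero[OF S])+
  qed
  then have "s + w \<in> T" "s - w \<in> T" "p + q \<in> T" "p - q \<in> T"
    by (auto intro: subalg_add[OF T] subalg_diff[OF T])
  moreover have "s + w = of_nat 2 * weyl_Z i" "s - w = of_nat 2 * weyl_Z j"
    "p + q = of_nat 2 * weyl_D i" "p - q = of_nat 2 * weyl_D j"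
    by (simp_all add: s_def p_def w_def q_def mult_2)
  ultimately have gen: "weyl_Z i \<in> T" "weyl_Z j \<in> T" "weyl_D i \<in> T" "weyl_D j \<in> T"
    using subalg_of_nat_cancel[OF T, of 2] by simp_all
  have "x = i \<or> x = j" for x
    using ij(1) by blast
  with gen have "weyl_Z x \<in> T" "weyl_D x \<in> T" for x
    by metis+
  then have "a \<in> T"
    by (rule weyl_subalgebra_eq_UNIV[OF T])
  moreover have "1 \<in> M"
    using M[of 1 0 0] subalg_one[OF S] subalg_zero[OF S] by simp
  ultimately have "1 * a \<in> M"
    by (simp only: T_def mem_Collect_eq)
  then obtain h h' h'' where h: "a = h + (h' * w + h'' * q)" "h \<in> S" "h' \<in> S" "h'' \<in> S"
    by (auto simp: M_def add.assoc)
  let ?\<sigma> = "Perm.swap i j"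
  have act_S: "weyl_act ?\<sigma> x = x" if "x \<in> S \<or> x = a" for x
    using that inv a by (auto simp: weyl_invariants_def)
  have act_minus: "weyl_act ?\<sigma> (x - y) = weyl_act ?\<sigma> x - weyl_act ?\<sigma> y" for x y
    by (metis add_diff_cancel_right' diff_add_cancel weyl_act_hom(2))
  have "weyl_act ?\<sigma> w = - w" "weyl_act ?\<sigma> q = - q"
    by (simp_all add: w_def q_def act_minus weyl_act_Z weyl_act_D)
  then have "weyl_act ?\<sigma> a = h - (h' * w + h'' * q)"
    unfolding h(1) by (simp add: weyl_act_hom act_S h)
  then have "a = h - (h' * w + h'' * q)"
    by (simp add: act_S)
  \<comment> \<open>Adding the two expressions for \<open>a\<close> cancels the sign-changing
    part.\<close>
  from arg_cong2[OF h(1) this, of "(+)"] have "a + a = h + h"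
    by simp
  then have "of_nat 2 * a \<in> S"
    using subalg_add[OF S h(2) h(2)] by (simp add: mult_2)
  then show "a \<in> S"
    by (rule subalg_of_nat_cancel[OF S]) simp
qed

section \<open>Case distinction on the number of variables\<close>

theorem theorem2p1p1:
  shows "weyl_subalgebra hull
      {(\<Sum>j\<in>UNIV. weyl_Z j),
       (\<Sum>j\<in>UNIV. weyl_Z j ^ CARD('n)),
       (\<Sum>j\<in>UNIV. weyl_D j ^ CARD('n))}
    = (weyl_invariants :: 'n::finite weyl set)"
    (is "weyl_subalgebra hull ?G = _")
proof
  define S where "S = weyl_subalgebra hull ?G"
  have S: "weyl_subalgebra S"
    unfolding S_def by (rule weyl_subalgebra_hull)
  have "?G \<subseteq> S"
    unfolding S_def by (rule hull_subset)
  then have gens: "(\<Sum>j\<in>UNIV. weyl_Z j) \<in> S" "(\<Sum>j\<in>UNIV. weyl_Z j ^ CARD('n)) \<in> S"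
    "(\<Sum>j\<in>UNIV. weyl_D j ^ CARD('n)) \<in> S"
    by blast+
  have act_power: "weyl_act \<sigma> (x ^ m) = weyl_act \<sigma> x ^ m" for \<sigma> m and x :: "'n weyl"
    by (induction m) (simp_all add: weyl_act_hom)
  have "?G \<subseteq> weyl_invariants"
    by (auto intro!: sum_invariant simp: act_power weyl_act_Z weyl_act_D)
  then have inv: "S \<subseteq> weyl_invariants"
    unfolding S_def by (intro hull_minimal weyl_subalgebra_invariants)
  then show "weyl_subalgebra hull ?G \<subseteq> weyl_invariants"
    by (simp only: S_def)
  consider "CARD('n) = 1" | "CARD('n) = 2" | "CARD('n) \<ge> 3"
    using zero_less_card_finite[where 'a = 'n] by linarith
  then have "weyl_invariants \<subseteq> S"
  proof cases
    case 1
    then obtain i :: 'n where i: "UNIV = {i}"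
      by (meson card_1_singletonE)
    \<comment> \<open>With a single variable the first and third generators are z and \<partial>
      themselves.\<close>
    have "weyl_Z i \<in> S" "weyl_D i \<in> S"
      using gens(1,3) unfolding 1 i by simp_all
    moreover have "x = i" for x
      using i by blast
    ultimately have "weyl_Z x \<in> S" "weyl_D x \<in> S" for x
      by (metis (full_types))+
    then have "a \<in> S" for a
      by (rule weyl_subalgebra_eq_UNIV[OF S])
    then show ?thesis by blast
  next
    case 2
    note gens2 = gens[unfolded 2]
    \<comment> \<open>The rule \<open>order_refl\<close> instantiates k to 2, so the squares are
      among the given generators.\<close>
    show ?thesis
      by (intro invariants_subset_two_variables[OF S inv 2] gens2 subalg_D1[OF S order_refl gens2]
          subalg_ZD[OF S order_refl gens2])
  next
    case 3
    then have "(\<Sum>j\<in>UNIV. weyl_Z j ^ a * weyl_D j ^ b) \<in> S" for a b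
      using gens by (intro subalg_monomial[OF S, of "CARD('n)"]) auto
    then show ?thesis
      by (intro invariants_subset_if_word_sums[OF S] subalg_word_sum[OF S])
  qed
  then show "weyl_invariants \<subseteq> weyl_subalgebra hull ?G"
    by (simp only: S_def)
qed

end
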